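(* Let $T=2$ and $N\in\mathbb{N}$ (with $N\ge 1$). Let $\tilde\mu$ be a real number with $\tilde\mu<-N^2$. Then there is no choice of real numbers $a_1,\ldots,a_N$ satisfying $a_1+\cdots+a_N=1$ such that, for every $\mu\in(\tilde\mu,1)$, all of the roots of the polynomial $p(\lambda)=\lambda^{(N-1)T+1}-\mu\,(q(\lambda))^T$, where $q(\lambda)=a_1\lambda^{N-1}+\cdots+a_{N-1}\lambda+a_N$, lie in the unit disc $\{z\in\mathbb{C}:|z|<1\}$.
   Context: For $T,N\in\mathbb{N}$, real $a_1,\ldots,a_N$ with $a_1+\cdots+a_N=1$, and real $\mu$, define $q(\lambda)=a_1\lambda^{N-1}+\cdots+a_{N-1}\lambda+a_N$ and $p(\lambda)=\lambda^{(N-1)T+1}-\mu\,(q(\lambda))^T$. Here $T=2$, so $p(\lambda)=\lambda^{2N-1}-\mu\,(q(\lambda))^2$. *)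

theory Defs
  imports Complex_Main "HOL-Computational_Algebra.Polynomial"
begin

(* Coefficients a_1, ..., a_N are given as a function on nat; only its values on {1..N} are used. *)

definition q_poly :: "nat \<Rightarrow> (nat \<Rightarrow> real) \<Rightarrow> real poly" where
  "q_poly N a = (\<Sum>j = 1..N. monom (a j) (N - j))"

definition p_poly :: "nat \<Rightarrow> nat \<Rightarrow> (nat \<Rightarrow> real) \<Rightarrow> real \<Rightarrow> real poly" where
  "p_poly T N a \<mu> = monom 1 ((N - 1) * T + 1) - smult \<mu> (q_poly N a ^ T)"

end

theory Submission
  imports Defs
begin

text \<open>
  Write $C(t) = \sum_j a_j \cos((2j-1)t)$ and $S(t) = \sum_j a_j \sin((2j-1)t)$. At $\lambda = e^{-2it}$
  the polynomial $p$ vanishes exactly when $1 = \mu\,(C(t) + iS(t))^2$. So if $C(\theta) = 0$ and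
  $S(\theta) \<noteq> 0$, then $\mu = -1/S(\theta)^2$ yields a root on the unit circle, and this $\mu$ lies
  in $[-N^2, 0)$ as soon as $S(\theta) \<ge> 1/N$. The theorem therefore follows once every
  normalised $a$ admits a zero of $C$ with $S \<ge> 1/N$
  (\<open>exists_zero_of_cos_sum_with_large_sin_sum\<close>).

  To find that zero, regard $C$ as a polynomial in $x = \cos t$, a combination of Chebyshev
  polynomials of odd degree below $2N$; thus $C(1) = 1$ and $C(-1) = -1$. For a root $z = \cos\theta$ let
  $Q = C/(x - z)$. The mean of $Q$ over the $2N$ equidistant angles $\pi i/N$ equals
  $S(\theta)/\sin\theta$ (\<open>sum_divided_difference_equidistant\<close>), a discrete form of the integral that
  expresses $S$ as the conjugate function of $C$. The two angles $0$ and $\pi$ alone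
  contribute $Q(1) + Q(-1) = 1/(1-z) + 1/(1+z) = 2/\sin^2\theta$ to the sum. If the other nodes
  contribute a nonnegative amount, then $S(\theta) \<ge> 1/(N\sin\theta) \<ge> 1/N$.

  A single quotient $Q$ need not be nonnegative on $[-1,1]$. But let
  $y_1 < \dots < y_r$ be the sign changes of $C$ in $(-1,1)$; their number $r$ is odd. The rational
  function $g = \prod_{k\,\mathrm{even}}(x - y_k) / \prod_{k\,\mathrm{odd}}(x - y_k)$ has the same sign
  as $C$, and because its zeros and poles interlace, its partial fraction decomposition
  $g = \sum_k c_k/(x - y_k)$ has positive coefficients. So a convex combination of the quotients
  $C/(x - y_k)$ is nonnegative on $[-1,1]$, and for any nonnegative weights at least one of
  the quotients has a nonnegative weighted sum (\<open>divided_difference_sum_nonneg\<close>).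
\<close>

section \<open>A root whose divided difference has nonnegative weighted sum\<close>

lemma poly_linear_factor:
  fixes Q :: "'a::comm_ring_1 poly"
  shows "poly ([:- z, 1:] * Q) x = (x - z) * poly Q x"
  by (simp add: algebra_simps)

text \<open>
  The interlacing argument, arranged as an induction that removes the two smallest roots
  $y \<le> y'$ of $C = (x-y)(x-y')D$ at a time and moves the factor $(x-y')^2$ into the weights.
  If $D = (x-z)G$, then
  \[ (x-y')^2\, G = \frac{z-y'}{z-y}\cdot\frac{C}{x-z} + \frac{y'-y}{z-y}\cdot\frac{C}{x-y}, \]
  a convex combination when $y < y' \<le> z$. So one of the two quotients inherits the
  nonnegative sum.
\<close>

lemma divided_difference_sum_nonneg:
  fixes C :: "real poly" and x w :: "'i \<Rightarrow> real" and a b :: real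
  assumes "a < b" and "poly C a < 0" and "poly C b > 0"
    and "\<And>i. i \<in> I \<Longrightarrow> w i \<ge> 0" and "\<And>i. i \<in> I \<Longrightarrow> x i \<in> {a..b}"
  shows "\<exists>z Q. a < z \<and> z < b \<and> C = [:- z, 1:] * Q \<and> (\<Sum>i\<in>I. w i * poly Q (x i)) \<ge> 0"
  using assms(2-4)
proof (induction "degree C" arbitrary: C w rule: less_induct)
  case less
  define R where "R p = {y. a < y \<and> y < b \<and> poly p y = 0}" for p :: "real poly"
  have finR: "finite (R p)" if "p \<noteq> 0" for p
    by (rule finite_subset[OF _ poly_roots_finite[OF that]]) (auto simp: R_def)
  have factor: "\<exists>q. p = [:- y, 1:] * q" if "poly p y = 0" for p :: "real poly" and y
    using that by (auto simp: poly_eq_0_iff_dvd dvd_def)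
  have "C \<noteq> 0" using less.prems by auto
  have "R C \<noteq> {}"
    using poly_IVT_pos[OF \<open>a < b\<close> less.prems(1,2)] by (auto simp: R_def)
  define y where "y = Min (R C)"
  have "y \<in> R C" and y_le: "\<And>v. v \<in> R C \<Longrightarrow> y \<le> v"
    using finR[OF \<open>C \<noteq> 0\<close>] \<open>R C \<noteq> {}\<close> by (auto simp: y_def)
  then have y: "a < y" "y < b" "poly C y = 0" by (auto simp: R_def)
  obtain E where E: "C = [:- y, 1:] * E" using factor[OF y(3)] by blast
  have "E \<noteq> 0" using \<open>C \<noteq> 0\<close> E by auto
  have "poly E b > 0"
    using less.prems(2) y by (simp add: E poly_linear_factor zero_less_mult_iff del: mult_pCons_left)
  show ?case
  proof (cases "R E = {}")
    case True
    \<comment> \<open>The root \<open>y\<close> is the only one in the interval, so the quotient \<open>E\<close> keeps its sign there.\<close>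
    have "poly E v \<ge> 0" if "v \<in> {a..b}" for v
    proof (rule ccontr)
      assume "\<not> poly E v \<ge> 0"
      then have "poly E v < 0" and "v < b"
        using \<open>poly E b > 0\<close> that by (auto simp: less_le)
      from poly_IVT_pos[OF this(2,1) \<open>poly E b > 0\<close>] that True
      show False by (auto simp: R_def)
    qed
    then have "(\<Sum>i\<in>I. w i * poly E (x i)) \<ge> 0"
      using less.prems(3) assms(5) by (intro sum_nonneg) auto
    then show ?thesis using E y by blast
  next
    case False
    define y' where "y' = Min (R E)"
    have "y' \<in> R E" and y'_le: "\<And>v. v \<in> R E \<Longrightarrow> y' \<le> v"
      using finR[OF \<open>E \<noteq> 0\<close>] False by (auto simp: y'_def)
    then have y': "a < y'" "y' < b" "poly E y' = 0" by (auto simp: R_def)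
    have "y \<le> y'" using y' by (intro y_le) (auto simp: R_def E)
    obtain D where D: "E = [:- y', 1:] * D" using factor[OF y'(3)] by blast
    have C: "C = [:- y, 1:] * ([:- y', 1:] * D)" by (simp only: E D)
    have "D \<noteq> 0" using \<open>E \<noteq> 0\<close> D by auto
    then have deg: "degree D < degree C"
      by (simp add: C degree_mult_eq del: mult_pCons_left)
    have "poly D b > 0"
      using \<open>poly E b > 0\<close> y' by (simp add: D poly_linear_factor zero_less_mult_iff del: mult_pCons_left)
    have "poly C a = ((y - a) * (y' - a)) * poly D a"
      by (simp add: C poly_linear_factor algebra_simps del: mult_pCons_left)
    moreover have "(y - a) * (y' - a) > 0" using y y' by simp
    ultimately have "poly D a < 0"
      using less.prems(1) by (metis mult_less_0_iff not_less_iff_gr_or_eq)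
    define w' where "w' i = w i * (x i - y')\<^sup>2" for i
    have "\<exists>z G. a < z \<and> z < b \<and> D = [:- z, 1:] * G \<and> (\<Sum>i\<in>I. w' i * poly G (x i)) \<ge> 0"
      by (rule less.hyps[OF deg \<open>poly D a < 0\<close> \<open>poly D b > 0\<close>])
        (auto simp: w'_def less.prems(3))
    then obtain z G where z: "a < z" "z < b" and G: "D = [:- z, 1:] * G"
      and pos: "(\<Sum>i\<in>I. w' i * poly G (x i)) \<ge> 0" by blast
    have "y' \<le> z" using z by (intro y'_le) (auto simp: R_def D G)
    show ?thesis
    proof (cases "y = y'")
      case True
      \<comment> \<open>A double root does not change the sign, so it is absorbed by the weights alone.\<close>
      define Q where "Q = [:- y', 1:] * ([:- y', 1:] * G)"
      have "C = [:- z, 1:] * Q" unfolding C G Q_def True by (simp only: mult_ac)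
      moreover have "(\<Sum>i\<in>I. w i * poly Q (x i)) = (\<Sum>i\<in>I. w' i * poly G (x i))"
        by (intro sum.cong) (auto simp: Q_def w'_def power2_eq_square algebra_simps)
      ultimately show ?thesis using z pos by (intro exI[of _ z] exI[of _ Q]) simp
    next
      case False
      then have "y < y'" using \<open>y \<le> y'\<close> by simp
      define P where "P = [:- y, 1:] * ([:- y', 1:] * G)"
      define Q where "Q = [:- y', 1:] * ([:- z, 1:] * G)"
      have CP: "C = [:- z, 1:] * P" unfolding C G P_def by (simp only: mult_ac)
      have CQ: "C = [:- y, 1:] * Q" unfolding C G Q_def by (simp only: mult_ac)
      have "(z - y) * (\<Sum>i\<in>I. w' i * poly G (x i)) =
          (z - y') * (\<Sum>i\<in>I. w i * poly P (x i)) + (y' - y) * (\<Sum>i\<in>I. w i * poly Q (x i))"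
        unfolding sum_distrib_left sum.distrib[symmetric]
        by (intro sum.cong) (auto simp: P_def Q_def w'_def power2_eq_square algebra_simps)
      moreover have "(z - y) * (\<Sum>i\<in>I. w' i * poly G (x i)) \<ge> 0"
        using pos \<open>y < y'\<close> \<open>y' \<le> z\<close> by simp
      ultimately have "\<not> ((\<Sum>i\<in>I. w i * poly P (x i)) < 0 \<and> (\<Sum>i\<in>I. w i * poly Q (x i)) < 0)"
        using \<open>y < y'\<close> \<open>y' \<le> z\<close>
        by (smt (verit) mult_nonneg_nonpos mult_pos_neg)
      then consider "(\<Sum>i\<in>I. w i * poly P (x i)) \<ge> 0" | "(\<Sum>i\<in>I. w i * poly Q (x i)) \<ge> 0"
        by linarith
      then show ?thesis
        by cases (use CP CQ y(1,2) z in blast)+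
    qed
  qed
qed

section \<open>Chebyshev polynomials and their divided differences\<close>

lemma smult_sum_right: "smult c (\<Sum>i\<in>A. f i) = (\<Sum>i\<in>A. smult c (f i))"
  by (induction A rule: infinite_finite_induct) (simp_all add: smult_add_right)

fun cheb_poly :: "nat \<Rightarrow> real poly" where
  "cheb_poly 0 = 1"
| "cheb_poly (Suc 0) = [:0, 1:]"
| "cheb_poly (Suc (Suc n)) = [:0, 2:] * cheb_poly (Suc n) - cheb_poly n"

lemma cos_Suc_Suc:
  fixes t :: real
  shows "cos (real (Suc (Suc n)) * t) = 2 * cos t * cos (real (Suc n) * t) - cos (real n * t)"
proof -
  have "real (Suc (Suc n)) * t = real (Suc n) * t + t" "real n * t = real (Suc n) * t - t"
    by (simp_all add: algebra_simps)
  then show ?thesis by (simp only: cos_add cos_diff) (simp add: algebra_simps)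
qed

lemma sin_Suc_Suc:
  fixes t :: real
  shows "sin (real (Suc (Suc n)) * t) = 2 * cos t * sin (real (Suc n) * t) - sin (real n * t)"
proof -
  have "real (Suc (Suc n)) * t = real (Suc n) * t + t" "real n * t = real (Suc n) * t - t"
    by (simp_all add: algebra_simps)
  then show ?thesis by (simp only: sin_add sin_diff) (simp add: algebra_simps)
qed

lemma poly_cheb_poly_cos: "poly (cheb_poly n) (cos t) = cos (real n * t)"
proof (induction n rule: cheb_poly.induct)
  case (3 n)
  then show ?case by (simp add: cos_Suc_Suc del: of_nat_Suc)
qed auto

text \<open>
  This is $\sin\theta\,\bigl(T_n(x) - T_n(\cos\theta)\bigr)/(x - \cos\theta)$ in the Chebyshev basis.
  The factor $\sin\theta$ keeps the coefficients free of division, and the expansion displays the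
  constant coefficient $\sin(n\theta)$, the only one that survives averaging over
  equidistant angles.
\<close>

definition cheb_quotient :: "real \<Rightarrow> nat \<Rightarrow> real poly" where
  "cheb_quotient \<theta> n =
     (\<Sum>k<n. smult ((if k = 0 then 1 else 2) * sin (real (n - k) * \<theta>)) (cheb_poly k))"

lemma cheb_quotient_Suc_Suc:
  "cheb_quotient \<theta> (Suc (Suc n)) =
     smult (2 * cos \<theta>) (cheb_quotient \<theta> (Suc n)) - cheb_quotient \<theta> n
     + smult (2 * sin \<theta>) (cheb_poly (Suc n))"
proof -
  define e :: "nat \<Rightarrow> real" where "e k = (if k = 0 then 1 else 2)" for k
  define f where "f m k = smult (e k * sin (real (m - k) * \<theta>)) (cheb_poly k)" for m k
  have Q: "cheb_quotient \<theta> m = (\<Sum>k<m. f m k)" for m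
    by (simp add: cheb_quotient_def f_def e_def)
  have rec: "f (Suc (Suc n)) k = smult (2 * cos \<theta>) (f (Suc n) k) - f n k" if "k \<le> n" for k
  proof -
    have "Suc (Suc n) - k = Suc (Suc (n - k))" "Suc n - k = Suc (n - k)"
      using that by auto
    then show ?thesis
      unfolding f_def
      by (simp only: sin_Suc_Suc smult_smult smult_diff_left[symmetric])
        (simp add: algebra_simps)
  qed
  have "(\<Sum>k\<le>n. f (Suc (Suc n)) k)
      = smult (2 * cos \<theta>) (\<Sum>k\<le>n. f (Suc n) k) - (\<Sum>k\<le>n. f n k)"
    unfolding smult_sum_right sum_subtractf[symmetric] by (intro sum.cong) (auto simp: rec)
  moreover have "(\<Sum>k\<le>n. f n k) = (\<Sum>k<n. f n k)"
    by (simp add: lessThan_Suc_atMost[symmetric] f_def)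
  ultimately show ?thesis
    by (simp add: Q lessThan_Suc_atMost[symmetric]) (simp add: f_def e_def)
qed

lemma linear_factor_mult_cheb_quotient:
  "[:- cos \<theta>, 1:] * cheb_quotient \<theta> n = smult (sin \<theta>) (cheb_poly n - [:cos (real n * \<theta>):])"
proof (induction n rule: cheb_poly.induct)
  case (3 n)
  have "poly ([:- cos \<theta>, 1:] * cheb_quotient \<theta> (Suc (Suc n))) x =
     poly (smult (sin \<theta>) (cheb_poly (Suc (Suc n)) - [:cos (real (Suc (Suc n)) * \<theta>):])) x" for x
    using arg_cong[OF 3(1), of "\<lambda>p. poly p x"] arg_cong[OF 3(2), of "\<lambda>p. poly p x"]
    unfolding cheb_quotient_Suc_Suc cos_Suc_Suc
    by (simp add: del: of_nat_Suc) algebra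
  then show ?case by (simp add: poly_eq_poly_eq_iff[symmetric] fun_eq_iff)
qed (simp_all add: cheb_quotient_def one_pCons)

section \<open>Averaging over equidistant angles\<close>

lemma sum_cos_equidistant:
  assumes "k < m"
  shows "(\<Sum>i<m. cos (real k * (2 * pi * real i / real m))) = (if k = 0 then real m else 0)"
proof (cases "k = 0")
  case False
  define \<omega> where "\<omega> = cis (2 * pi * real k / real m)"
  have "real m * (2 * pi * real k / real m) = 2 * pi * real k" using assms by simp
  then have "\<omega> ^ m = 1"
    unfolding \<omega>_def DeMoivre by (metis cis_multiple_2pi Ints_of_nat)
  \<comment> \<open>\<open>\<omega> \<noteq> 1\<close>, because the real part of \<open>\<omega>\<close> is \<open>1 - 2 sin\<^sup>2 (\<pi> k / m)\<close>.\<close>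
  have "sin (pi * real k / real m) > 0"
    using assms False by (intro sin_gt_zero) (auto simp: field_simps)
  then have "Re \<omega> < 1"
    using cos_double_sin[of "pi * real k / real m"] by (simp add: \<omega>_def mult.assoc)
  then have "\<omega> \<noteq> 1" by auto
  have "(\<Sum>i<m. \<omega> ^ i) = 0"
    using \<open>\<omega> ^ m = 1\<close> \<open>\<omega> \<noteq> 1\<close> by (simp add: sum_gp_strict)
  then have "Re (\<Sum>i<m. \<omega> ^ i) = 0" by simp
  then show ?thesis using False by (simp add: \<omega>_def DeMoivre algebra_simps)
qed simp

text \<open>
  The discrete counterpart of the principal value integral
  $\frac1\pi\int_0^\pi \frac{\cos(nt)}{\cos t - \cos\theta}\,dt = \frac{\sin(n\theta)}{\sin\theta}$.
  Dividing $T_n$ by a linear factor lowers the degree below $n \<le> m$, where averaging over $m$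
  equidistant angles annihilates every nonconstant Chebyshev polynomial.
\<close>

lemma sum_divided_difference_equidistant:
  fixes d :: "'j \<Rightarrow> nat"
  assumes C: "(\<Sum>j\<in>J. smult (a j) (cheb_poly (d j))) = [:- cos \<theta>, 1:] * Q"
    and d: "\<And>j. j \<in> J \<Longrightarrow> d j \<le> m"
  shows "sin \<theta> * (\<Sum>i<m. poly Q (cos (2 * pi * real i / real m)))
       = real m * (\<Sum>j\<in>J. a j * sin (real (d j) * \<theta>))"
proof -
  define D where "D = (\<Sum>j\<in>J. smult (a j) (cheb_quotient \<theta> (d j)))"
  have "(\<Sum>j\<in>J. a j * cos (real (d j) * \<theta>)) = poly (\<Sum>j\<in>J. smult (a j) (cheb_poly (d j))) (cos \<theta>)"
    by (simp add: poly_sum poly_cheb_poly_cos)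
  then have zero: "(\<Sum>j\<in>J. a j * cos (real (d j) * \<theta>)) = 0" by (simp add: C)
  have "[:- cos \<theta>, 1:] * D = (\<Sum>j\<in>J. smult (a j) ([:- cos \<theta>, 1:] * cheb_quotient \<theta> (d j)))"
    unfolding D_def by (simp only: sum_distrib_left mult_smult_right)
  also have "\<dots> = (\<Sum>j\<in>J. smult (sin \<theta>) (smult (a j) (cheb_poly (d j))))
      - (\<Sum>j\<in>J. smult (sin \<theta>) [:a j * cos (real (d j) * \<theta>):])"
    unfolding linear_factor_mult_cheb_quotient sum_subtractf[symmetric]
    by (intro sum.cong) (auto simp: smult_diff_right mult_ac)
  also have "\<dots> = smult (sin \<theta>) (\<Sum>j\<in>J. smult (a j) (cheb_poly (d j)))
      - smult (sin \<theta>) [:\<Sum>j\<in>J. a j * cos (real (d j) * \<theta>):]"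
    by (rule poly_eqI)
      (simp add: coeff_sum coeff_pCons sum_distrib_left mult.assoc split: nat.split)
  also have "\<dots> = [:- cos \<theta>, 1:] * smult (sin \<theta>) Q"
    by (simp only: C zero) simp
  finally have D_eq: "D = smult (sin \<theta>) Q"
    by (subst (asm) mult_cancel_left) simp
  have one: "(\<Sum>i<m. poly (cheb_quotient \<theta> n) (cos (2 * pi * real i / real m)))
      = real m * sin (real n * \<theta>)" if "n \<le> m" for n
  proof -
    define c where "c k = (if k = 0 then 1 else 2) * sin (real (n - k) * \<theta>)" for k
    have "(\<Sum>i<m. poly (cheb_quotient \<theta> n) (cos (2 * pi * real i / real m)))
        = (\<Sum>i<m. \<Sum>k<n. c k * cos (real k * (2 * pi * real i / real m)))"
      by (simp add: cheb_quotient_def poly_sum poly_cheb_poly_cos c_def)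
    also have "\<dots> = (\<Sum>k<n. c k * (\<Sum>i<m. cos (real k * (2 * pi * real i / real m))))"
      by (subst sum.swap) (simp add: sum_distrib_left)
    also have "\<dots> = (\<Sum>k<n. c k * (if k = 0 then real m else 0))"
      using that by (intro sum.cong refl arg_cong2[of _ _ _ _ "(*)"] sum_cos_equidistant) auto
    also have "\<dots> = (\<Sum>k<n. if k = 0 then real m * sin (real n * \<theta>) else 0)"
      by (intro sum.cong) (auto simp: c_def)
    also have "\<dots> = real m * sin (real n * \<theta>)" by (cases n) auto
    finally show ?thesis .
  qed
  have "sin \<theta> * (\<Sum>i<m. poly Q (cos (2 * pi * real i / real m)))
      = (\<Sum>i<m. poly D (cos (2 * pi * real i / real m)))"
    by (simp add: D_eq sum_distrib_left)
  also have "\<dots> = (\<Sum>j\<in>J. a j * (\<Sum>i<m. poly (cheb_quotient \<theta> (d j)) (cos (2 * pi * real i / real m))))"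
    unfolding D_def poly_sum by (subst sum.swap) (simp add: sum_distrib_left)
  also have "\<dots> = real m * (\<Sum>j\<in>J. a j * sin (real (d j) * \<theta>))"
    unfolding sum_distrib_left by (intro sum.cong) (auto simp: one d sum_distrib_left[symmetric])
  finally show ?thesis .
qed

section \<open>A root on the unit circle\<close>

text \<open>
  This is where the bound $N$ arises: the choice of $\theta$ makes the nodes other than $\pm 1$
  contribute nonnegatively to the $2N$-point sum of the quotient, and the values at $\pm 1$ are
  explicit. The mechanism is the one behind Fejer's inequality
  $P(0) \<le> N \cdot \mathrm{mean}(P)$ for nonnegative trigonometric polynomials of degree
  below $N$.
\<close>

lemma exists_zero_of_cos_sum_with_large_sin_sum:
  fixes a :: "nat \<Rightarrow> real"
  assumes "N \<ge> 1" and a: "(\<Sum>j = 1..N. a j) = 1"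
  shows "\<exists>\<theta>. (\<Sum>j = 1..N. a j * cos (real (2 * j - 1) * \<theta>)) = 0
    \<and> (\<Sum>j = 1..N. a j * sin (real (2 * j - 1) * \<theta>)) \<ge> 1 / real N"
proof -
  define C where "C = (\<Sum>j = 1..N. smult (a j) (cheb_poly (2 * j - 1)))"
  define x where "x i = cos (2 * pi * real i / real (2 * N))" for i
  have C_cos: "poly C (cos t) = (\<Sum>j = 1..N. a j * cos (real (2 * j - 1) * t))" for t
    by (simp add: C_def poly_sum poly_cheb_poly_cos)
  have C1: "poly C 1 = 1" using C_cos[of 0] a by simp
  have "cos (real (2 * j - 1) * pi) = - 1" if "j \<in> {1..N}" for j
    using that by (simp add: cos_npi del: of_nat_diff)
  then have "poly C (- 1) = (\<Sum>j = 1..N. a j * (- 1))"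
    using C_cos[of pi] by simp
  then have Cm1: "poly C (- 1) = - 1" using a by (simp add: sum_negf)
  have "\<exists>z Q. - 1 < z \<and> z < 1 \<and> C = [:- z, 1:] * Q
      \<and> (\<Sum>i\<in>{..<2 * N} - {0, N}. 1 * poly Q (x i)) \<ge> 0"
    by (rule divided_difference_sum_nonneg) (auto simp: C1 Cm1 x_def)
  then obtain z Q where z: "- 1 < z" "z < 1" and Q: "C = [:- z, 1:] * Q"
    and pos: "(\<Sum>i\<in>{..<2 * N} - {0, N}. poly Q (x i)) \<ge> 0" by auto
  define \<theta> where "\<theta> = arccos z"
  have cos: "cos \<theta> = z" and s: "sin \<theta> > 0" 
    using z by (simp_all add: \<theta>_def sin_gt_zero arccos_lt_bounded)
  have "(sin \<theta>)\<^sup>2 = (1 - z) * (1 + z)"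
    using sin_squared_eq[of \<theta>] by (simp add: cos power2_eq_square algebra_simps)
  have x0: "x 0 = 1" and xN: "x N = - 1" using \<open>N \<ge> 1\<close> by (simp_all add: x_def)
  have "(\<Sum>i<2 * N. poly Q (x i)) = poly Q 1 + poly Q (- 1) + (\<Sum>i\<in>{..<2 * N} - {0, N}. poly Q (x i))"
    using \<open>N \<ge> 1\<close> sum.subset_diff[of "{0, N}" "{..<2 * N}" "\<lambda>i. poly Q (x i)"]
    by (auto simp: x0 xN)
  then have "(\<Sum>i<2 * N. poly Q (x i)) \<ge> poly Q 1 + poly Q (- 1)" using pos by simp
  also have "poly Q 1 = 1 / (1 - z)" using C1 z by (simp add: Q field_simps)
  also have "poly Q (- 1) = 1 / (1 + z)" using Cm1 z by (simp add: Q field_simps)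
  also have "1 / (1 - z) + 1 / (1 + z) = 2 / (sin \<theta>)\<^sup>2"
    using z unfolding \<open>(sin \<theta>)\<^sup>2 = _\<close> by (simp add: field_simps)
  finally have "sin \<theta> * (2 / (sin \<theta>)\<^sup>2) \<le> sin \<theta> * (\<Sum>i<2 * N. poly Q (x i))"
    using s by (intro mult_left_mono) auto
  also have "\<dots> = real (2 * N) * (\<Sum>j = 1..N. a j * sin (real (2 * j - 1) * \<theta>))"
    unfolding x_def
    by (rule sum_divided_difference_equidistant) (use Q in \<open>auto simp: C_def cos\<close>)
  finally have "2 / sin \<theta> \<le> real (2 * N) * (\<Sum>j = 1..N. a j * sin (real (2 * j - 1) * \<theta>))"
    using s by (simp add: power2_eq_square)
  moreover have "2 \<le> 2 / sin \<theta>" using s by (simp add: field_simps)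
  ultimately have "1 / real N \<le> (\<Sum>j = 1..N. a j * sin (real (2 * j - 1) * \<theta>))"
    using \<open>N \<ge> 1\<close> by (simp add: field_simps)
  moreover have "(\<Sum>j = 1..N. a j * cos (real (2 * j - 1) * \<theta>)) = 0"
    using C_cos[of \<theta>] by (simp add: Q cos)
  ultimately show ?thesis by blast
qed

lemma poly_of_real_p_poly:
  "poly (map_poly complex_of_real (p_poly T N a \<mu>)) z =
     z ^ ((N - 1) * T + 1) - of_real \<mu> * (\<Sum>j = 1..N. of_real (a j) * z ^ (N - j)) ^ T"
proof -
  have mult: "map_poly complex_of_real (p * q) = map_poly of_real p * map_poly of_real q" for p q
    by (rule poly_eqI) (simp add: coeff_map_poly coeff_mult)
  have power: "map_poly complex_of_real (p ^ n) = map_poly of_real p ^ n" for p n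
    by (induction n) (simp_all add: mult)
  have diff: "map_poly complex_of_real (p - q) = map_poly of_real p - map_poly of_real q" for p q
    by (rule poly_eqI) (simp add: coeff_map_poly)
  have smult: "map_poly complex_of_real (smult c p) = smult (of_real c) (map_poly of_real p)" for c p
    by (rule poly_eqI) (simp add: coeff_map_poly)
  have sum: "map_poly complex_of_real (\<Sum>j\<in>A. f j) = (\<Sum>j\<in>A. map_poly of_real (f j))"
    for A :: "nat set" and f
    by (rule poly_eqI) (simp add: coeff_map_poly coeff_sum)
  show ?thesis
    by (simp add: p_poly_def q_poly_def mult power diff smult sum map_poly_monom poly_sum poly_monom)
qed

theorem theorem4:
  fixes N :: nat and \<mu>' :: real
  assumes "N \<ge> 1"
    and "\<mu>' < - (real N)\<^sup>2"
  shows "\<not> (\<exists>a :: nat \<Rightarrow> real. (\<Sum>j = 1..N. a j) = 1 \<and>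
      (\<forall>\<mu> \<in> {\<mu>'<..<1}. \<forall>z :: complex.
         poly (map_poly complex_of_real (p_poly 2 N a \<mu>)) z = 0 \<longrightarrow> z \<in> {w. cmod w < 1}))"
proof
  assume "\<exists>a :: nat \<Rightarrow> real. (\<Sum>j = 1..N. a j) = 1 \<and>
      (\<forall>\<mu> \<in> {\<mu>'<..<1}. \<forall>z :: complex.
         poly (map_poly complex_of_real (p_poly 2 N a \<mu>)) z = 0 \<longrightarrow> z \<in> {w. cmod w < 1})"
  then obtain a where a: "(\<Sum>j = 1..N. a j) = 1"
    and stable: "\<And>\<mu> z. \<mu>' < \<mu> \<Longrightarrow> \<mu> < 1 \<Longrightarrow>
      poly (map_poly complex_of_real (p_poly 2 N a \<mu>)) z = 0 \<Longrightarrow> cmod z < 1"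
    by auto
  obtain \<theta> where c: "(\<Sum>j = 1..N. a j * cos (real (2 * j - 1) * \<theta>)) = 0"
    and S_ge: "(\<Sum>j = 1..N. a j * sin (real (2 * j - 1) * \<theta>)) \<ge> 1 / real N"
    using exists_zero_of_cos_sum_with_large_sin_sum[OF \<open>N \<ge> 1\<close> a] by blast
  define S where "S = (\<Sum>j = 1..N. a j * sin (real (2 * j - 1) * \<theta>))"
  \<comment> \<open>Multiplication by the unimodular \<open>u\<close> turns the exponents \<open>N - j\<close> in \<open>q\<close> into the odd frequencies.\<close>
  define z where "z = cis (- 2 * \<theta>)"
  define u where "u = cis (real (2 * N - 1) * \<theta>)"
  define q where "q = (\<Sum>j = 1..N. of_real (a j) * z ^ (N - j))"
  define \<mu> where "\<mu> = - 1 / S\<^sup>2"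
  have "S > 0" "1 / real N \<le> S" using S_ge \<open>N \<ge> 1\<close> by (auto simp: S_def intro: less_le_trans[rotated])
  then have "1 / S \<le> real N" using \<open>N \<ge> 1\<close> by (simp add: field_simps)
  then have "(1 / S)\<^sup>2 \<le> (real N)\<^sup>2" using \<open>S > 0\<close> by (intro power_mono) auto
  then have "\<mu>' < \<mu>" using assms(2) by (simp add: \<mu>_def power_divide)
  have "\<mu> < 0" using \<open>S > 0\<close> by (simp add: \<mu>_def)
  have "u * z ^ (N - j) = cis (real (2 * j - 1) * \<theta>)" if "j \<in> {1..N}" for j
    using that by (simp add: u_def z_def DeMoivre cis_mult of_nat_diff algebra_simps)
  then have "u * q = (\<Sum>j = 1..N. of_real (a j) * cis (real (2 * j - 1) * \<theta>))"
    unfolding q_def sum_distrib_left by (intro sum.cong) (auto simp: mult.left_commute)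
  also have "\<dots> = \<i> * of_real S"
    using c by (auto simp: complex_eq_iff S_def Re_sum Im_sum)
  finally have uq: "u * q = \<i> * of_real S" .
  have u_z: "u\<^sup>2 * z ^ (2 * N - 1) = 1"
    using \<open>N \<ge> 1\<close> by (simp add: u_def z_def DeMoivre cis_mult of_nat_diff algebra_simps)
  have "(N - 1) * 2 + 1 = 2 * N - 1" using \<open>N \<ge> 1\<close> by simp
  then have "poly (map_poly complex_of_real (p_poly 2 N a \<mu>)) z = z ^ (2 * N - 1) - of_real \<mu> * q\<^sup>2"
    by (simp add: poly_of_real_p_poly q_def)
  then have "u\<^sup>2 * poly (map_poly complex_of_real (p_poly 2 N a \<mu>)) z
      = u\<^sup>2 * z ^ (2 * N - 1) - of_real \<mu> * (u * q)\<^sup>2"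
    by (simp only: power_mult_distrib right_diff_distrib mult.left_commute)
  also have "\<dots> = 1 + of_real (\<mu> * S\<^sup>2)"
    unfolding u_z uq by (simp add: power_mult_distrib)
  also have "\<dots> = 0" using \<open>S > 0\<close> by (simp add: \<mu>_def)
  finally have "poly (map_poly complex_of_real (p_poly 2 N a \<mu>)) z = 0"
    by (simp add: u_def)
  with stable \<open>\<mu>' < \<mu>\<close> \<open>\<mu> < 0\<close> have "cmod z < 1" by auto
  then show False by (simp add: z_def)
qed

end
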